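(* For every natural number $k\ge 1$ there exist constants $C>0$ and $N$, depending only on $k$, such that for every $n>N$, every set $E\subset\mathbb{R}^2$ of $n$ points, and every $k$-tuple $(\alpha_1,\dots,\alpha_k)$ of nonzero real numbers, the number of $k$-chains of type $(\alpha_1,\dots,\alpha_k)$ in $E$ is at most $$C\, n^{\frac{2(k+1)}{3}}.$$
   Context: For a $k$-tuple $(\alpha_1,\dots,\alpha_k)$ of real numbers, a $k$-chain of type $(\alpha_1,\dots,\alpha_k)$ in a finite set $E$ is a $(k+1)$-tuple $(R_1,\dots,R_{k+1})\in E^{k+1}$ such that $R_j\cdot R_{j+1}=\alpha_j$ for all $j=1,\dots,k$, where $\cdot$ is the standard dot product. Repetitions among the $R_j$ are not excluded. *)

theory Defs
  imports "HOL-Analysis.Analysis"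
begin

text \<open>Tuples are lists. List indices start at 0, so the list entries \<open>R ! j\<close> and \<open>\<alpha> ! j\<close>
  are the entries number \<open>j + 1\<close> of the tuples, and the type \<open>\<alpha>\<close> has length \<open>k\<close>.\<close>

definition dot_chains :: "real list \<Rightarrow> (real ^ 2) set \<Rightarrow> (real ^ 2) list set" where
  "dot_chains \<alpha> E = {R. length R = length \<alpha> + 1 \<and> set R \<subseteq> E \<and>
     (\<forall>j < length \<alpha>. (R ! j) \<bullet> (R ! (j + 1)) = \<alpha> ! j)}"

end

theory Submission
  imports Defs
begin

text \<open>The bound multiplies under concatenation. Deleting the condition that links the second point of a chain
to the third one splits the chain into a 1-chain and a chain with two points fewer, so a 1-chain bound of
order \<open>n powr (4/3)\<close> and a bound of order \<open>n powr (2 * (k - 1) / 3)\<close> for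
\<open>k - 2\<close> links give \<open>n powr (2 * (k + 1) / 3)\<close> for \<open>k\<close> links. Only
\<open>k = 1\<close> and \<open>k = 2\<close> remain.

For \<open>k = 2\<close> the outer two points impose two linear equations on the middle one. Either these
determine it, or the last point is a fixed multiple of the first; in both cases two of the three points
determine the chain, which gives \<open>2 n\<^sup>2\<close> (\<open>card_dot_chains_2\<close>).

For \<open>k = 1\<close> and \<open>x \<noteq> 0\<close> the points \<open>y\<close> with
\<open>x \<bullet> y = a\<close> form a line, and \<open>a \<noteq> 0\<close> excludes \<open>x = 0\<close> and makes different \<open>x\<close> give different lines. So the pairs are incidences
between \<open>n\<close> points and at most \<open>n\<close> lines, and the claim is the Szemeredi--Trotter theorem
(\<open>szemeredi_trotter\<close>). It is obtained from the crossing inequality, as in Szekely's proof: join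
consecutive points on every line. The resulting graph has nearly as many edges as there are incidences,
and it has at most one crossing for each ordered pair of lines. Conversely, a graph with many edges must
have many crossings: a graph without crossings has at most three times as many edges as vertices
(\<open>card_planar_edges\<close>), hence in general the number of edges is at most three times the number of
vertices plus the number of crossings, and averaging this over random vertex sets turns it into the
strong form \<open>crossing_inequality\<close>.

The linear bound for graphs without crossings is proved without Euler's formula, by a charging argument.
Two edges that leave a vertex to the right and are consecutive in the order of slopes bound a wedge; the
pair is charged to the leftmost vertex that lies in this wedge. Absence of crossings implies that a vertex
is charged at most twice.\<close>

section \<open>Straight-line graphs in the plane\<close>

text \<open>An edge is the pair of its left and its right end. Edges are never vertical, so that an edge is the graph
of an affine function over an interval; \<open>height e\<close> is this function, extended to the whole line.\<close>

definition slope :: "(real \<times> real) \<times> (real \<times> real) \<Rightarrow> real" where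
  "slope e = (snd (snd e) - snd (fst e)) / (fst (snd e) - fst (fst e))"

definition height :: "(real \<times> real) \<times> (real \<times> real) \<Rightarrow> real \<Rightarrow> real" where
  "height e x = snd (fst e) + slope e * (x - fst (fst e))"

text \<open>The last condition says that no vertex lies in the interior of an edge. In particular two edges with the
same left end never overlap, so slopes distinguish them.\<close>

definition straight_graph :: "(real \<times> real) set \<Rightarrow> ((real \<times> real) \<times> (real \<times> real)) set \<Rightarrow> bool" where
  "straight_graph V F \<longleftrightarrow> finite V \<and> F \<subseteq> V \<times> V \<and>
     (\<forall>e\<in>F. fst (fst e) < fst (snd e) \<and>
        (\<forall>v\<in>V. fst (fst e) < fst v \<and> fst v < fst (snd e) \<longrightarrow> snd v \<noteq> height e (fst v)))"

text \<open>The edge \<open>e\<close> passes from below \<open>f\<close> to above \<open>f\<close>. This relation is not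
symmetric: every crossing is recorded by exactly one ordered pair. Phrasing it by a change of sign avoids
computing the point of intersection.\<close>

definition crosses :: "(real \<times> real) \<times> (real \<times> real) \<Rightarrow> (real \<times> real) \<times> (real \<times> real) \<Rightarrow> bool" where
  "crosses e f \<longleftrightarrow> (\<exists>x y. x < y \<and> fst (fst e) \<le> x \<and> fst (fst f) \<le> x \<and>
      y \<le> fst (snd e) \<and> y \<le> fst (snd f) \<and> height e x < height f x \<and> height f y < height e y)"

lemma height_left [simp]: "height e (fst (fst e)) = snd (fst e)"
  by (simp add: height_def)

lemma height_right [simp]: "fst (fst e) < fst (snd e) \<Longrightarrow> height e (fst (snd e)) = snd (snd e)"
  by (simp add: height_def slope_def)

lemma height_mono_slope:
  assumes "fst e = fst f" "slope e \<le> slope f" "fst (fst e) \<le> x"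
  shows "height e x \<le> height f x"
  using assms by (simp add: height_def mult_right_mono)

lemma height_strict_mono_slope:
  assumes "fst e = fst f" "slope e < slope f" "fst (fst e) < x"
  shows "height e x < height f x"
  using assms by (simp add: height_def)

lemma straight_graph_edge:
  assumes "straight_graph V F" "e \<in> F"
  shows "fst e \<in> V" "snd e \<in> V" "fst (fst e) < fst (snd e)"
proof -
  have "e \<in> V \<times> V" "fst (fst e) < fst (snd e)"
    using assms unfolding straight_graph_def by blast+
  then show "fst e \<in> V" "snd e \<in> V" "fst (fst e) < fst (snd e)"
    by (auto simp: mem_Times_iff)
qed

lemma finite_straight_graph: "straight_graph V F \<Longrightarrow> finite F"
  unfolding straight_graph_def by (blast intro: finite_subset finite_cartesian_product)

lemma straight_graph_subgraph:
  assumes "straight_graph V F" "V' \<subseteq> V" "F' \<subseteq> F" "F' \<subseteq> V' \<times> V'"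
  shows "straight_graph V' F'"
  unfolding straight_graph_def
proof (intro conjI ballI impI)
  show "finite V'"
    using assms(1,2) unfolding straight_graph_def by (blast intro: finite_subset)
qed (use assms straight_graph_edge(3)[OF assms(1)] in \<open>unfold straight_graph_def, blast+\<close>)

lemma vertex_on_edge:
  assumes "straight_graph V F" "e \<in> F" "v \<in> V"
    and "fst (fst e) < fst v" "fst v \<le> fst (snd e)" "snd v = height e (fst v)"
  shows "v = snd e"
proof -
  have "\<not> fst v < fst (snd e)"
    using assms(2-4,6) assms(1)[unfolded straight_graph_def] by blast
  then have "fst v = fst (snd e)"
    using assms(5) by simp
  then show ?thesis
    using assms(6) straight_graph_edge(3)[OF assms(1,2)] by (simp add: prod_eq_iff)
qed

text \<open>Otherwise the shorter edge would end in the interior of the longer one.\<close>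

lemma edge_eqI:
  assumes G: "straight_graph V F" and "e \<in> F" "f \<in> F" "fst e = fst f" "slope e = slope f"
  shows "e = f"
proof -
  have "snd e = snd f" if "e \<in> F" "f \<in> F" "fst e = fst f" "slope e = slope f"
      "fst (snd e) \<le> fst (snd f)" for e f
  proof (rule vertex_on_edge[OF G that(2)])
    have "height f = height e" using that by (auto simp: height_def)
    then show "snd (snd e) = height f (fst (snd e))"
      using straight_graph_edge(3)[OF G that(1)] by simp
    show "fst (fst f) < fst (snd e)"
      using straight_graph_edge(3)[OF G that(1)] that(3) by simp
  qed (use that straight_graph_edge[OF G] in auto)
  from this[of e f] this[of f e] assms have "snd e = snd f"
    by (metis linear)
  then show ?thesis using assms(4) by (simp add: prod_eq_iff)
qed

section \<open>Graphs without crossings have few edges\<close>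

text \<open>The edge \<open>f\<close> is the next steeper one after \<open>e\<close> at their common left end. The two
bound a wedge, cut off at the first of the two right ends, and \<open>w\<close> is a leftmost vertex in the
closed wedge other than its apex.\<close>

definition wedge_tip :: "(real \<times> real) set \<Rightarrow> ((real \<times> real) \<times> (real \<times> real)) set \<Rightarrow>
    (real \<times> real) \<times> (real \<times> real) \<Rightarrow> (real \<times> real) \<times> (real \<times> real) \<Rightarrow> real \<times> real \<Rightarrow> bool" where
  "wedge_tip V F e f w \<longleftrightarrow> e \<in> F \<and> f \<in> F \<and> fst e = fst f \<and> slope e < slope f \<and>
     (\<forall>g\<in>F. fst g = fst e \<longrightarrow> slope e < slope g \<longrightarrow> slope f \<le> slope g) \<and>
     w \<in> V \<and> fst (fst e) < fst w \<and> fst w \<le> fst (snd e) \<and> fst w \<le> fst (snd f) \<and>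
     height e (fst w) \<le> snd w \<and> snd w \<le> height f (fst w) \<and>
     (\<forall>v\<in>V. fst (fst e) < fst v \<longrightarrow> fst v < fst w \<longrightarrow> height e (fst v) \<le> snd v \<longrightarrow>
        \<not> snd v \<le> height f (fst v))"

lemma wedge_tipD:
  assumes "wedge_tip V F e f w"
  shows "e \<in> F" "f \<in> F" "fst e = fst f" "slope e < slope f" "w \<in> V"
    "fst (fst e) < fst w" "fst w \<le> fst (snd e)" "fst w \<le> fst (snd f)"
    "height e (fst w) \<le> snd w" "snd w \<le> height f (fst w)"
  using assms unfolding wedge_tip_def by - (elim conjE, assumption)+

lemma wedge_tip_consecutive:
  assumes "wedge_tip V F e f w" "g \<in> F" "fst g = fst e" "slope e < slope g"
  shows "slope f \<le> slope g"
  using assms(1) unfolding wedge_tip_def by (elim conjE) (use assms(2-) in blast)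

lemma wedge_tip_first:
  assumes "wedge_tip V F e f w" "v \<in> V" "fst (fst e) < fst v" "fst v < fst w" "height e (fst v) \<le> snd v"
  shows "height f (fst v) < snd v"
proof -
  have "\<not> snd v \<le> height f (fst v)"
    using assms(1) unfolding wedge_tip_def by (elim conjE) (use assms(2-) in blast)
  then show ?thesis by simp
qed

lemma finite_has_least_value:
  fixes h :: "'a \<Rightarrow> real"
  assumes "finite A" "A \<noteq> {}"
  obtains x where "x \<in> A" "\<forall>y\<in>A. h x \<le> h y"
  using that[OF arg_min_if_finite(1)[OF assms, of h]] arg_min_least[OF assms, of _ h] by blast

text \<open>The wedge contains a vertex because the nearer of the two right ends lies in it.\<close>

lemma wedge_tip_exists:
  assumes G: "straight_graph V F" and e: "e \<in> F"
    and nontop: "\<exists>g\<in>F. fst g = fst e \<and> slope e < slope g"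
  shows "\<exists>f w. wedge_tip V F e f w"
proof -
  let ?A = "{g \<in> F. fst g = fst e \<and> slope e < slope g}"
  have "finite ?A"
    using finite_straight_graph[OF G] by simp
  moreover have "?A \<noteq> {}"
    using nontop by blast
  ultimately obtain f where f: "f \<in> ?A" and fmin: "\<forall>g\<in>?A. slope f \<le> slope g"
    by (rule finite_has_least_value)
  let ?W = "{v \<in> V. fst (fst e) < fst v \<and> fst v \<le> fst (snd e) \<and> fst v \<le> fst (snd f) \<and>
      height e (fst v) \<le> snd v \<and> snd v \<le> height f (fst v)}"
  have "finite ?W"
    using G by (simp add: straight_graph_def)
  moreover have "?W \<noteq> {}"
  proof (cases "fst (snd e) \<le> fst (snd f)")
    case True
    then have "snd e \<in> ?W"
      using straight_graph_edge[OF G e] f height_mono_slope[of e f "fst (snd e)"] by auto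
    then show ?thesis by blast
  next
    case False
    then have "snd f \<in> ?W"
      using straight_graph_edge[OF G, of f] f height_mono_slope[of e f "fst (snd f)"] by auto
    then show ?thesis by blast
  qed
  ultimately obtain w where w: "w \<in> ?W" and wmin: "\<forall>v\<in>?W. fst w \<le> fst v"
    by (rule finite_has_least_value)
  have f': "f \<in> F" "fst e = fst f" "slope e < slope f"
    using f by simp_all
  have fmin': "slope f \<le> slope g" if "g \<in> F" "fst g = fst e" "slope e < slope g" for g
    using fmin that by blast
  have w': "w \<in> V" "fst (fst e) < fst w" "fst w \<le> fst (snd e)" "fst w \<le> fst (snd f)"
      "height e (fst w) \<le> snd w" "snd w \<le> height f (fst w)"
    using w by blast+
  have wmin': "fst w \<le> fst v" if "v \<in> V" "fst (fst e) < fst v" "fst v \<le> fst (snd e)"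
      "fst v \<le> fst (snd f)" "height e (fst v) \<le> snd v" "snd v \<le> height f (fst v)" for v
    using wmin that by blast
  have "wedge_tip V F e f w"
    unfolding wedge_tip_def
  proof (intro conjI ballI impI)
    fix v assume "v \<in> V" "fst (fst e) < fst v" "fst v < fst w" "height e (fst v) \<le> snd v"
    then show "\<not> snd v \<le> height f (fst v)"
      using w' wmin'[of v] by linarith
  qed (fact e f' w' | rule fmin', assumption+)+
  then show ?thesis by blast
qed

text \<open>The wedge of \<open>e1\<close> and \<open>f1\<close> contains no vertex left of \<open>w\<close>, so the apex
\<open>p2\<close> of the second wedge either is the apex of the first or lies above \<open>f1\<close> or below
\<open>e1\<close>. In the first case both wedges are sectors between neighbouring edges at the same vertex, so
they are equal or share at most a side. In the second case \<open>e2\<close> starts above \<open>f1\<close>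
but passes below \<open>f1\<close> at the abscissa of \<open>w\<close>, so the two cross; in the third case
\<open>f2\<close> crosses \<open>e1\<close> for the same reason.

If \<open>w\<close> may be an upper right end for only one of the wedges, this fails: \<open>w\<close> can lie
on the upper side of one wedge and on the lower side of the wedge above. This is why a vertex may be
charged twice and why the hypothesis \<open>same\<close> is there.\<close>

lemma wedge_tip_unique_aux:
  assumes G: "straight_graph V F"
    and planar: "\<And>e f. e \<in> F \<Longrightarrow> f \<in> F \<Longrightarrow> \<not> crosses e f"
    and 1: "wedge_tip V F e1 f1 w" and 2: "wedge_tip V F e2 f2 w"
    and same: "w = snd f1 \<longleftrightarrow> w = snd f2"
    and le: "fst (fst e1) \<le> fst (fst e2)"
  shows "e1 = e2"
proof -
  note E = straight_graph_edge[OF G]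
  note F = wedge_tipD(1,2)[OF 1] wedge_tipD(1,2)[OF 2] wedge_tipD(5)[OF 1]
    and s = wedge_tipD(3)[OF 1, symmetric] wedge_tipD(3)[OF 2, symmetric]
    and b1 = wedge_tipD(7,8,9,10)[OF 1] and b2 = wedge_tipD(7,8,9,10)[OF 2]
    and x2 = wedge_tipD(6)[OF 1] wedge_tipD(6)[OF 2]
  have st1: "height e1 (fst w) < height f1 (fst w)"
    by (rule height_strict_mono_slope) (use wedge_tipD[OF 1] in blast)+
  have st2: "height e2 (fst w) < height f2 (fst w)"
    by (rule height_strict_mono_slope) (use wedge_tipD[OF 2] in blast)+
  have x1: "fst (fst f1) < fst w" "fst (fst f2) < fst w"
    using x2 by (simp_all only: s)
  \<comment> \<open>A vertex on an edge, but not at its left end, is its right end, so \<open>w\<close> is either strictly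
    below both upper sides or the right end of both.\<close>
  have tip: "snd w < height f1 (fst w) \<and> snd w < height f2 (fst w) \<or>
      snd w = height f1 (fst w) \<and> snd w = height f2 (fst w)"
  proof (cases "w = snd f1")
    case True
    then show ?thesis
      using height_right[OF E(3)[OF F(2)]] height_right[OF E(3)[OF F(4)]] same by metis
  next
    case False
    then have "snd w \<noteq> height f1 (fst w)" "snd w \<noteq> height f2 (fst w)"
      using vertex_on_edge[OF G F(2,5) x1(1) b1(2)] vertex_on_edge[OF G F(4,5) x1(2) b2(2)] same
      by blast+
    then show ?thesis
      using b1(4) b2(4) by linarith
  qed
  let ?x = "fst (fst e2)" and ?y = "snd (fst e2)"
  consider (inside) "height e1 ?x \<le> ?y" "?y \<le> height f1 ?x" | (above) "height f1 ?x < ?y"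
    | (below) "?y < height e1 ?x"
    by linarith
  then show ?thesis
  proof cases
    case inside
    have "\<not> fst (fst e1) < ?x"
      using wedge_tip_first[OF 1, of "fst e2"] inside E(1)[OF F(3)] x2 by fastforce
    then have "fst (fst e1) = ?x" using le by simp
    moreover from this have "snd (fst e1) = ?y"
      using inside height_left[of e1] height_left[of f1] s by simp
    ultimately have p: "fst e1 = fst e2" by (simp add: prod_eq_iff)
    consider "slope e1 = slope e2" | "slope e1 < slope e2" | "slope e2 < slope e1"
      by linarith
    then show ?thesis
    proof cases
      case 1
      then show ?thesis using edge_eqI[OF G F(1,3) p] by simp
    next
      case 2
      then have "slope f1 \<le> slope e2"
        using wedge_tip_consecutive[OF \<open>wedge_tip V F e1 f1 w\<close>] F p by simp
      then have "height f1 (fst w) \<le> height e2 (fst w)"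
        using height_mono_slope[of f1 e2 "fst w"] p s x2 by simp
      then show ?thesis
        using tip st2 b1(4) b2(3) by linarith
    next
      case 3
      then have "slope f2 \<le> slope e1"
        using wedge_tip_consecutive[OF \<open>wedge_tip V F e2 f2 w\<close>] F p by simp
      then have "height f2 (fst w) \<le> height e1 (fst w)"
        using height_mono_slope[of f2 e1 "fst w"] p s x2 by simp
      then show ?thesis
        using tip st1 b1(3) b2(4) by linarith
    qed
  next
    case above
    have "height e2 (fst w) < height f1 (fst w)"
      using tip st2 b2(3) by linarith
    then have "crosses f1 e2"
      unfolding crosses_def using above x2 b1 b2 le s height_left[of e2]
      by (intro exI[of _ ?x] exI[of _ "fst w"]) simp
    then show ?thesis using planar F by blast
  next
    case below
    have "height e1 (fst w) < height f2 (fst w)"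
      using tip st1 b1(3) by linarith
    then have "crosses f2 e1"
      unfolding crosses_def using below x2 b1 b2 le s height_left[of f2]
      by (intro exI[of _ ?x] exI[of _ "fst w"]) simp
    then show ?thesis using planar F by blast
  qed
qed

lemma wedge_tip_unique:
  assumes "straight_graph V F" "\<And>e f. e \<in> F \<Longrightarrow> f \<in> F \<Longrightarrow> \<not> crosses e f"
    and "wedge_tip V F e1 f1 w" "wedge_tip V F e2 f2 w" "w = snd f1 \<longleftrightarrow> w = snd f2"
  shows "e1 = e2"
proof (cases "fst (fst e1) \<le> fst (fst e2)")
  case True
  then show ?thesis using wedge_tip_unique_aux[OF assms] by simp
next
  case False
  then show ?thesis using wedge_tip_unique_aux[OF assms(1,2,4,3)] assms(5) by simp
qed

text \<open>An edge that is the steepest at its left end is determined by this end. Every other edge is charged to the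
tip of its wedge, and the tip determines the edge up to the Boolean value that tells whether the tip is
the right end of the upper side.\<close>

lemma card_planar_edges:
  assumes G: "straight_graph V F" and planar: "\<And>e f. e \<in> F \<Longrightarrow> f \<in> F \<Longrightarrow> \<not> crosses e f"
  shows "card F \<le> 3 * card V"
proof -
  note E = straight_graph_edge[OF G]
  have finV: "finite V" using G by (simp add: straight_graph_def)
  have finF: "finite F" using finite_straight_graph[OF G] .
  define N where "N = {e \<in> F. \<exists>g\<in>F. fst g = fst e \<and> slope e < slope g}"
  have "card (F - N) \<le> card V"
  proof (rule card_inj_on_le[of fst])
    show "inj_on fst (F - N)"
    proof (rule inj_onI)
      fix e f assume ef: "e \<in> F - N" "f \<in> F - N" "fst e = fst f"
      then have "\<not> slope e < slope f" "\<not> slope f < slope e"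
        unfolding N_def by auto
      then show "e = f"
        using edge_eqI[OF G] ef by simp
    qed
  qed (use E finV in auto)
  moreover have "card N \<le> card (V \<times> (UNIV :: bool set))"
  proof -
    have "\<forall>e\<in>N. \<exists>f w. wedge_tip V F e f w"
      using wedge_tip_exists[OF G] by (auto simp: N_def)
    then obtain f w where fw: "\<And>e. e \<in> N \<Longrightarrow> wedge_tip V F e (f e) (w e)"
      by metis
    show ?thesis
    proof (rule card_inj_on_le[of "\<lambda>e. (w e, w e = snd (f e))"])
      show "inj_on (\<lambda>e. (w e, w e = snd (f e))) N"
      proof (rule inj_onI)
        fix e e' assume "e \<in> N" "e' \<in> N" "(w e, w e = snd (f e)) = (w e', w e' = snd (f e'))"
        then show "e = e'"
          using wedge_tip_unique[OF G planar fw[of e], of e' "f e'"] fw[of e'] by auto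
      qed
      show "(\<lambda>e. (w e, w e = snd (f e))) ` N \<subseteq> V \<times> UNIV"
        using fw by (auto simp: wedge_tip_def)
    qed (use finV in simp)
  qed
  moreover have "card F = card (F - N) + card N"
  proof -
    have "card ((F - N) \<union> N) = card (F - N) + card N"
      by (rule card_Un_disjoint) (use finF in \<open>auto simp: N_def\<close>)
    moreover have "(F - N) \<union> N = F" by (auto simp: N_def)
    ultimately show ?thesis by simp
  qed
  ultimately show ?thesis
    by (simp add: card_cartesian_product)
qed

section \<open>The crossing inequality\<close>

text \<open>Deleting one edge of every crossing pair leaves a graph without crossings.\<close>

lemma card_edges_le_crossings:
  assumes G: "straight_graph V F"
  shows "card F \<le> 3 * card V + card {(e, f) \<in> F \<times> F. crosses e f}"
proof -
  let ?X = "{(e, f) \<in> F \<times> F. crosses e f}"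
  have finF: "finite F" using finite_straight_graph[OF G] .
  have finX: "finite ?X" by (rule finite_subset[of _ "F \<times> F"]) (use finF in auto)
  have "F \<subseteq> V \<times> V"
    using G unfolding straight_graph_def by blast
  then have "straight_graph V (F - fst ` ?X)"
    by (intro straight_graph_subgraph[OF G]) blast+
  then have "card (F - fst ` ?X) \<le> 3 * card V"
    by (rule card_planar_edges) force
  moreover have "card F - card (fst ` ?X) \<le> card (F - fst ` ?X)"
    by (rule diff_card_le_card_Diff) (use finX in simp)
  moreover have "card (fst ` ?X) \<le> card ?X"
    using finX by (rule card_image_le)
  ultimately show ?thesis by linarith
qed

lemma crosses_point:
  assumes "crosses e f"
  obtains z where "fst (fst e) < z" "z < fst (snd e)" "fst (fst f) < z" "z < fst (snd f)"
    "height e z = height f z" "slope e \<noteq> slope f"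
proof -
  obtain x y where xy: "x < y" "fst (fst e) \<le> x" "fst (fst f) \<le> x" "y \<le> fst (snd e)"
      "y \<le> fst (snd f)" "height e x < height f x" "height f y < height e y"
    using assms unfolding crosses_def by blast
  have "continuous_on {x..y} (\<lambda>u. height e u - height f u)"
    unfolding height_def by (intro continuous_intros)
  then obtain z where z: "x \<le> z" "z \<le> y" "height e z - height f z = 0"
    using IVT'[of "\<lambda>u. height e u - height f u" x 0 y] xy by auto
  then have "x \<noteq> z" "z \<noteq> y" using xy by auto
  moreover have "slope e \<noteq> slope f"
    using xy by (auto simp: height_def algebra_simps)
  ultimately show ?thesis using that[of z] z xy by linarith
qed

text \<open>The edges lie on different lines, which meet only at a point interior to both edges; so no end is shared.\<close>

lemma crosses_distinct_ends:
  assumes "crosses e f"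
  shows "card {fst e, snd e, fst f, snd f} = 4"
proof -
  obtain z where z: "fst (fst e) < z" "z < fst (snd e)" "fst (fst f) < z" "z < fst (snd f)"
    "height e z = height f z" "slope e \<noteq> slope f"
    using crosses_point[OF assms] .
  have agree: "u = z" if "height e u = height f u" for u
  proof -
    have "(slope e - slope f) * (u - z) = 0"
      using that z(5) by (simp add: height_def algebra_simps)
    then show ?thesis using z(6) by simp
  qed
  have "fst e \<noteq> fst f"
    using agree[of "fst (fst e)"] z(1) height_left[of e] height_left[of f] by force
  moreover have "snd e \<noteq> snd f"
    using agree[of "fst (snd e)"] z height_right[of e] height_right[of f] by force
  moreover have "fst e \<noteq> snd e" "fst e \<noteq> snd f" "snd e \<noteq> fst f" "fst f \<noteq> snd f"
    using z by auto
  ultimately show ?thesis by simp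
qed

text \<open>Colourings of the vertices with \<open>t\<close> colours model random vertex sets: the vertices of colour
\<open>0\<close> form a set that contains each vertex independently with probability \<open>1 / t\<close>. The
set contains \<open>A\<close> with probability \<open>1 / t ^ card A\<close>, stated here free of fractions.\<close>

lemma card_colourings_vanishing:
  fixes V :: "'a set"
  assumes "finite V" "A \<subseteq> V" "t \<ge> 1"
  shows "card {c \<in> V \<rightarrow>\<^sub>E {..<t::nat}. \<forall>a\<in>A. c a = 0} * t ^ card A = t ^ card V"
proof -
  have "{c \<in> V \<rightarrow>\<^sub>E {..<t}. \<forall>a\<in>A. c a = 0} = (\<Pi>\<^sub>E v\<in>V. if v \<in> A then {0} else {..<t})"
  proof (intro set_eqI)
    fix c :: "'a \<Rightarrow> nat"
    have "(\<forall>v\<in>V. c v < t) \<and> (\<forall>a\<in>A. c a = 0) \<longleftrightarrow> (\<forall>v\<in>V. c v \<in> (if v \<in> A then {0} else {..<t}))"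
      using assms(2,3) by (auto split: if_splits)
    then show "c \<in> {c \<in> V \<rightarrow>\<^sub>E {..<t}. \<forall>a\<in>A. c a = 0} \<longleftrightarrow> c \<in> (\<Pi>\<^sub>E v\<in>V. if v \<in> A then {0} else {..<t})"
      unfolding PiE_iff mem_Collect_eq lessThan_iff by blast
  qed
  then have "card {c \<in> V \<rightarrow>\<^sub>E {..<t}. \<forall>a\<in>A. c a = 0} = (\<Prod>v\<in>V. if v \<in> A then 1 else t)"
    using assms(1) by (simp add: card_PiE if_distrib cong: if_cong)
  also have "\<dots> = (\<Prod>v\<in>V - A. t)"
    using assms(1) by (simp add: prod.If_cases Diff_eq Int_commute)
  finally show ?thesis
    using assms(1,2) by (simp add: card_Diff_subset card_mono finite_subset flip: power_add)
qed

text \<open>Linearity of expectation: each of the objects \<open>z\<close> survives if all \<open>r\<close> points that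
it depends on are chosen, which has probability \<open>1 / t ^ r\<close>.\<close>

lemma sum_card_vanishing:
  fixes V :: "'a set" and ends :: "'b \<Rightarrow> 'a set"
  assumes V: "finite V" and Z: "finite Z" and t: "t \<ge> 1"
    and ends: "\<And>z. z \<in> Z \<Longrightarrow> ends z \<subseteq> V" "\<And>z. z \<in> Z \<Longrightarrow> card (ends z) = r"
  shows "(\<Sum>c \<in> V \<rightarrow>\<^sub>E {..<t::nat}. card {z \<in> Z. \<forall>a\<in>ends z. c a = 0}) * t ^ r = card Z * t ^ card V"
proof -
  let ?C = "V \<rightarrow>\<^sub>E {..<t}"
  have fin: "finite ?C" using V by (simp add: finite_PiE)
  have "(\<Sum>c\<in>?C. card {z \<in> Z. \<forall>a\<in>ends z. c a = 0}) = (\<Sum>z\<in>Z. card {c \<in> ?C. \<forall>a\<in>ends z. c a = 0})"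
    unfolding card_eq_sum sum.inter_filter[OF fin] sum.inter_filter[OF Z] by (rule sum.swap)
  then have "(\<Sum>c\<in>?C. card {z \<in> Z. \<forall>a\<in>ends z. c a = 0}) * t ^ r
      = (\<Sum>z\<in>Z. card {c \<in> ?C. \<forall>a\<in>ends z. c a = 0} * t ^ card (ends z))"
    using ends by (simp add: sum_distrib_right)
  also have "\<dots> = (\<Sum>z\<in>Z. t ^ card V)"
    by (rule sum.cong) (use card_colourings_vanishing[OF V _ t] ends in auto)
  finally show ?thesis by simp
qed

text \<open>In a random vertex set of density \<open>1 / t\<close> an edge survives with probability
\<open>1 / t\<^sup>2\<close>, a vertex with probability \<open>1 / t\<close>, and a crossing, having four
different ends, only with probability \<open>1 / t ^ 4\<close>. So the expected value of the weak inequality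
\<open>card_edges_le_crossings\<close> for the induced subgraph, multiplied by \<open>t ^ 4\<close>, gives a bound
in which crossings weigh much less than before. The parameter \<open>t\<close> is left free; it is
chosen where the inequality is applied.\<close>

lemma crossing_inequality:
  assumes G: "straight_graph V F" and t: "t \<ge> (1::nat)"
  shows "card F * t\<^sup>2 \<le> 3 * card V * t ^ 3 + card {(e, f) \<in> F \<times> F. crosses e f}"
proof -
  let ?X = "{(e, f) \<in> F \<times> F. crosses e f}"
  let ?C = "V \<rightarrow>\<^sub>E {..<t}"
  note E = straight_graph_edge[OF G]
  have finV: "finite V" using G by (simp add: straight_graph_def)
  have finF: "finite F" using finite_straight_graph[OF G] .
  have finX: "finite ?X" by (rule finite_subset[of _ "F \<times> F"]) (use finF in auto)
  define f where "f c = card {e \<in> F. \<forall>a\<in>{fst e, snd e}. c a = 0}" for c :: "real \<times> real \<Rightarrow> nat"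
  define v where "v c = card {u \<in> V. \<forall>a\<in>{u}. c a = 0}" for c :: "real \<times> real \<Rightarrow> nat"
  define x where "x c = card {z \<in> ?X. \<forall>a\<in>{fst (fst z), snd (fst z), fst (snd z), snd (snd z)}. c a = 0}"
    for c :: "real \<times> real \<Rightarrow> nat"
  have sum_f: "(\<Sum>c\<in>?C. f c) * t ^ 2 = card F * t ^ card V"
    unfolding f_def
  proof (rule sum_card_vanishing[OF finV finF t])
    fix e assume "e \<in> F"
    then have "fst e \<noteq> snd e" using E(3) by fastforce
    then show "card {fst e, snd e} = 2" by simp
  qed (use E in blast)
  have sum_v: "(\<Sum>c\<in>?C. v c) * t ^ 1 = card V * t ^ card V"
    unfolding v_def by (rule sum_card_vanishing[OF finV finV t]) auto
  have sum_x: "(\<Sum>c\<in>?C. x c) * t ^ 4 = card ?X * t ^ card V"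
    unfolding x_def
  proof (rule sum_card_vanishing[OF finV finX t])
    fix z assume "z \<in> ?X"
    then show "card {fst (fst z), snd (fst z), fst (snd z), snd (snd z)} = 4"
      using crosses_distinct_ends[of "fst z" "snd z"] by (simp add: case_prod_beta)
    from \<open>z \<in> ?X\<close> have "fst z \<in> F" "snd z \<in> F" by auto
    then show "{fst (fst z), snd (fst z), fst (snd z), snd (snd z)} \<subseteq> V"
      using E by simp
  qed
  have "f c \<le> 3 * v c + x c" for c
  proof -
    let ?V = "{u \<in> V. c u = 0}" and ?F = "{e \<in> F. c (fst e) = 0 \<and> c (snd e) = 0}"
    have "straight_graph ?V ?F"
      by (rule straight_graph_subgraph[OF G]) (use E in \<open>auto simp: mem_Times_iff\<close>)
    from card_edges_le_crossings[OF this]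
    have "card ?F \<le> 3 * card ?V + card {(e, f) \<in> ?F \<times> ?F. crosses e f}" .
    also have "{(e, f) \<in> ?F \<times> ?F. crosses e f} = {z \<in> ?X. \<forall>a\<in>{fst (fst z), snd (fst z), fst (snd z), snd (snd z)}. c a = 0}"
      by auto
    finally show ?thesis by (simp add: f_def v_def x_def)
  qed
  then have "(\<Sum>c\<in>?C. f c) \<le> (\<Sum>c\<in>?C. 3 * v c + x c)"
    by (intro sum_mono) simp
  then have "(\<Sum>c\<in>?C. f c) \<le> 3 * (\<Sum>c\<in>?C. v c) + (\<Sum>c\<in>?C. x c)"
    by (simp add: sum.distrib sum_distrib_left)
  then have "(\<Sum>c\<in>?C. f c) * t ^ 4 \<le> (3 * (\<Sum>c\<in>?C. v c) + (\<Sum>c\<in>?C. x c)) * t ^ 4"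
    by (rule mult_right_mono) simp
  also have "\<dots> = 3 * ((\<Sum>c\<in>?C. v c) * t ^ 1 * t ^ 3) + (\<Sum>c\<in>?C. x c) * t ^ 4"
    by (simp add: add_mult_distrib numeral_eq_Suc)
  also have "\<dots> = (3 * card V * t ^ 3 + card ?X) * t ^ card V"
    unfolding sum_v sum_x by (simp only: algebra_simps)
  also have "(\<Sum>c\<in>?C. f c) * t ^ 4 = (\<Sum>c\<in>?C. f c) * t ^ 2 * t ^ 2"
    by (simp flip: power_add)
  also have "\<dots> = (card F * t\<^sup>2) * t ^ card V"
    unfolding sum_f by (simp only: mult_ac)
  finally have "(card F * t\<^sup>2) * t ^ card V \<le> (3 * card V * t ^ 3 + card ?X) * t ^ card V" .
  then show ?thesis using t by simp
qed

section \<open>Points and lines\<close>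

text \<open>A line that is not vertical is the pair of its slope and its intercept.\<close>

definition on_line :: "real \<times> real \<Rightarrow> real \<times> real \<Rightarrow> bool" where
  "on_line p l \<longleftrightarrow> snd p = fst l * fst p + snd l"

definition consecutive_on :: "(real \<times> real) set \<Rightarrow> real \<times> real \<Rightarrow> (real \<times> real) \<times> (real \<times> real) \<Rightarrow> bool" where
  "consecutive_on V l e \<longleftrightarrow> fst e \<in> V \<and> snd e \<in> V \<and> fst (fst e) < fst (snd e) \<and>
     on_line (fst e) l \<and> on_line (snd e) l \<and>
     (\<forall>r\<in>V. on_line r l \<longrightarrow> \<not> (fst (fst e) < fst r \<and> fst r < fst (snd e)))"

lemma on_line_unique_point: "on_line p l \<Longrightarrow> on_line q l \<Longrightarrow> fst p = fst q \<Longrightarrow> p = q"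
  by (simp add: on_line_def prod_eq_iff)

lemma on_line_unique_line:
  assumes "on_line p l" "on_line q l" "on_line p m" "on_line q m" "fst p \<noteq> fst q"
  shows "l = m"
proof -
  have "(fst l - fst m) * (fst p - fst q) = 0"
    using assms(1-4) by (simp add: on_line_def algebra_simps)
  then have "fst l = fst m" using assms(5) by simp
  then show ?thesis using assms(1,3) by (simp add: on_line_def prod_eq_iff)
qed

lemma slope_height_consecutive:
  assumes "consecutive_on V l e"
  shows "slope e = fst l" "height e x = fst l * x + snd l"
proof -
  have e: "fst (fst e) < fst (snd e)" "snd (fst e) = fst l * fst (fst e) + snd l"
      "snd (snd e) = fst l * fst (snd e) + snd l"
    using assms unfolding consecutive_on_def on_line_def by blast+
  have "snd (snd e) - snd (fst e) = fst l * (fst (snd e) - fst (fst e))"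
    unfolding e by (simp add: algebra_simps)
  then show s: "slope e = fst l"
    using e(1) by (simp add: slope_def)
  show "height e x = fst l * x + snd l"
    unfolding height_def s e(2) by (simp add: algebra_simps)
qed

text \<open>A vertex over the interior of an edge is not on the line of this edge, because the ends of the edge are
consecutive on that line.\<close>

lemma straight_graph_consecutive:
  assumes "finite V"
  shows "straight_graph V {e. \<exists>l\<in>L. consecutive_on V l e}"
  unfolding straight_graph_def
proof (intro conjI ballI impI)
  show "{e. \<exists>l\<in>L. consecutive_on V l e} \<subseteq> V \<times> V"
    unfolding consecutive_on_def by (auto simp: mem_Times_iff)
next
  fix e v assume e: "e \<in> {e. \<exists>l\<in>L. consecutive_on V l e}" and v: "v \<in> V"
    "fst (fst e) < fst v \<and> fst v < fst (snd e)"
  then obtain l where l: "consecutive_on V l e" by blast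
  then have "\<not> on_line v l"
    using v unfolding consecutive_on_def by blast
  then show "snd v \<noteq> height e (fst v)"
    by (simp add: slope_height_consecutive[OF l] on_line_def)
next
  fix e assume "e \<in> {e. \<exists>l\<in>L. consecutive_on V l e}"
  then show "fst (fst e) < fst (snd e)"
    unfolding consecutive_on_def by blast
qed (fact assms)

lemma consecutive_on_unique:
  assumes e: "consecutive_on V l e" and f: "consecutive_on V l f"
    and z: "fst (fst e) < z" "z < fst (snd e)" "fst (fst f) < z" "z < fst (snd f)"
  shows "e = f"
proof -
  note D = consecutive_on_def
  have "fst (fst e) \<le> fst (fst f)" "fst (snd f) \<le> fst (snd e)"
    if "consecutive_on V l e" "consecutive_on V l f"
      "fst (fst e) < z" "z < fst (snd e)" "fst (fst f) < z" "z < fst (snd f)" for e f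
  proof -
    have "fst f \<in> V" "snd f \<in> V" "on_line (fst f) l" "on_line (snd f) l"
      using that(2) unfolding D by blast+
    moreover have "fst e \<in> V" "snd e \<in> V" "on_line (fst e) l" "on_line (snd e) l"
      using that(1) unfolding D by blast+
    ultimately have "\<not> (fst (fst f) < fst (fst e) \<and> fst (fst e) < fst (snd f))"
      "\<not> (fst (fst f) < fst (snd e) \<and> fst (snd e) < fst (snd f))"
      using that(2) unfolding D by blast+
    then show "fst (fst e) \<le> fst (fst f)" "fst (snd f) \<le> fst (snd e)"
      using that(3-) by linarith+
  qed
  from this[OF e f z] this[OF f e z(3,4,1,2)]
  have "fst (fst e) = fst (fst f)" "fst (snd e) = fst (snd f)"
    by linarith+
  then have "fst e = fst f" "snd e = snd f"
    using e f on_line_unique_point unfolding D by blast+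
  then show ?thesis by (simp add: prod_eq_iff)
qed

text \<open>Two lines of different slope meet in one point, and on each of them at most one edge has this point in
its interior. So a crossing is determined by the lines of its two edges.\<close>

lemma card_crossings_consecutive:
  fixes V L :: "(real \<times> real) set"
  assumes L: "finite L"
  defines "F \<equiv> {e. \<exists>l\<in>L. consecutive_on V l e}"
  shows "card {(e, f) \<in> F \<times> F. crosses e f} \<le> (card L)\<^sup>2"
proof -
  let ?X = "{(e, f) \<in> F \<times> F. crosses e f}"
  have "\<forall>e\<in>F. \<exists>l\<in>L. consecutive_on V l e"
    by (simp add: F_def)
  then obtain l where l: "\<And>e. e \<in> F \<Longrightarrow> l e \<in> L" "\<And>e. e \<in> F \<Longrightarrow> consecutive_on V (l e) e"
    by metis
  have "card ?X \<le> card (L \<times> L)"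
  proof (rule card_inj_on_le[of "\<lambda>(e, f). (l e, l f)"])
    show "inj_on (\<lambda>(e, f). (l e, l f)) ?X"
    proof (rule inj_onI)
      fix x y assume "x \<in> ?X" "y \<in> ?X" "(\<lambda>(e, f). (l e, l f)) x = (\<lambda>(e, f). (l e, l f)) y"
      then have F: "fst x \<in> F" "snd x \<in> F" "fst y \<in> F" "snd y \<in> F"
        and c: "crosses (fst x) (snd x)" "crosses (fst y) (snd y)"
        and same: "l (fst x) = l (fst y)" "l (snd x) = l (snd y)"
        by (simp_all add: case_prod_beta)
      obtain z where z: "fst (fst (fst x)) < z" "z < fst (snd (fst x))"
          "fst (fst (snd x)) < z" "z < fst (snd (snd x))"
          "height (fst x) z = height (snd x) z" "slope (fst x) \<noteq> slope (snd x)"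
        using crosses_point[OF c(1)] .
      obtain z' where z': "fst (fst (fst y)) < z'" "z' < fst (snd (fst y))"
          "fst (fst (snd y)) < z'" "z' < fst (snd (snd y))"
          "height (fst y) z' = height (snd y) z'"
        using crosses_point[OF c(2)] by blast
      note sh = slope_height_consecutive[OF l(2)]
      have "(fst (l (fst x)) - fst (l (snd x))) * (z - z') = 0"
        using z(5) z'(5) unfolding sh(2)[OF F(1)] sh(2)[OF F(2)] sh(2)[OF F(3)] sh(2)[OF F(4)] same
        by (simp add: algebra_simps)
      moreover have "fst (l (fst x)) \<noteq> fst (l (snd x))"
        using z(6) unfolding sh(1)[OF F(1)] sh(1)[OF F(2)] .
      ultimately have "z' = z" by simp
      then have "fst x = fst y" "snd x = snd y"
        using consecutive_on_unique[OF l(2)[OF F(1)], of "fst y" z]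
          consecutive_on_unique[OF l(2)[OF F(2)], of "snd y" z] l(2)[OF F(3)] l(2)[OF F(4)] same z z'
        by simp_all
      then show "x = y" by (simp add: prod_eq_iff)
    qed
    show "(\<lambda>(e, f). (l e, l f)) ` ?X \<subseteq> L \<times> L"
      using l(1) by auto
  qed (use L in simp)
  then show ?thesis
    by (simp add: card_cartesian_product power2_eq_square)
qed

text \<open>An incidence of \<open>p\<close> with \<open>l\<close> yields the edge from \<open>p\<close> to the next point
on \<open>l\<close>, unless \<open>p\<close> is the rightmost point on \<open>l\<close>. An edge has two
different points of its line, so it determines the line.\<close>

lemma card_incidences_le_consecutive:
  assumes V: "finite V" and L: "finite L"
  defines "F \<equiv> {e. \<exists>l\<in>L. consecutive_on V l e}"
  shows "card {(p, l) \<in> V \<times> L. on_line p l} \<le> card L + card F"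
proof -
  let ?I = "{(p, l) \<in> V \<times> L. on_line p l}"
  \<comment> \<open>the incidences at which no edge starts\<close>
  define A where "A = {(p, l) \<in> ?I. \<forall>q\<in>V. on_line q l \<longrightarrow> fst q \<le> fst p}"
  have finI: "finite ?I"
    by (rule finite_subset[of _ "V \<times> L"]) (use V L in auto)
  have finF: "finite F"
    unfolding F_def by (rule finite_straight_graph[OF straight_graph_consecutive[OF V]])
  have "card A \<le> card L"
  proof (rule card_inj_on_le[of snd])
    show "inj_on snd A"
    proof (rule inj_onI)
      fix x y assume xy: "x \<in> A" "y \<in> A" "snd x = snd y"
      then have x: "fst x \<in> V" "on_line (fst x) (snd x)" and y: "fst y \<in> V" "on_line (fst y) (snd x)"
        by (simp_all add: A_def case_prod_beta)
      moreover have "fst (fst x) = fst (fst y)"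
        using xy x y by (intro antisym) (simp_all add: A_def case_prod_beta)
      ultimately have "fst x = fst y"
        using on_line_unique_point by blast
      then show "x = y" using xy(3) by (simp add: prod_eq_iff)
    qed
    show "snd ` A \<subseteq> L" by (auto simp: A_def)
  qed (fact L)
  moreover have "card (?I - A) \<le> card F"
  proof -
    have "\<exists>q. consecutive_on V (snd x) (fst x, q)" if x: "x \<in> ?I - A" for x
    proof -
      let ?Q = "{q \<in> V. on_line q (snd x) \<and> fst (fst x) < fst q}"
      have "finite ?Q" using V by simp
      moreover have "?Q \<noteq> {}"
      proof -
        have "\<not> (\<forall>q\<in>V. on_line q (snd x) \<longrightarrow> fst q \<le> fst (fst x))"
          using x by (simp add: A_def case_prod_beta)
        then show ?thesis using not_le by blast
      qed
      ultimately obtain q where q: "q \<in> ?Q" and least: "\<forall>r\<in>?Q. fst q \<le> fst r"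
        by (rule finite_has_least_value)
      have "fst x \<in> V" "on_line (fst x) (snd x)"
        using x by (simp_all add: case_prod_beta)
      moreover have "\<not> (fst (fst x) < fst r \<and> fst r < fst q)" if "r \<in> V" "on_line r (snd x)" for r
      proof
        assume r: "fst (fst x) < fst r \<and> fst r < fst q"
        then have "fst q \<le> fst r" using least that by blast
        then show False using r by simp
      qed
      ultimately have "consecutive_on V (snd x) (fst x, q)"
        unfolding consecutive_on_def using q by simp
      then show ?thesis by blast
    qed
    then have "\<forall>x\<in>?I - A. \<exists>q. consecutive_on V (snd x) (fst x, q)" by blast
    from bchoice[OF this] obtain q
      where q: "\<And>x. x \<in> ?I - A \<Longrightarrow> consecutive_on V (snd x) (fst x, q x)"
      by blast
    show ?thesis
    proof (rule card_inj_on_le[of "\<lambda>x. (fst x, q x)"])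
      show "inj_on (\<lambda>x. (fst x, q x)) (?I - A)"
      proof (rule inj_onI)
        fix x y assume xy: "x \<in> ?I - A" "y \<in> ?I - A" "(fst x, q x) = (fst y, q y)"
        have "snd x = snd y"
          by (rule on_line_unique_line[of "fst x" _ "q x"])
            (use q[OF xy(1)] q[OF xy(2)] xy(3) in \<open>simp_all add: consecutive_on_def\<close>)
        then show "x = y" using xy(3) by (simp add: prod_eq_iff)
      qed
      show "(\<lambda>x. (fst x, q x)) ` (?I - A) \<subseteq> F"
        using q by (fastforce simp: F_def)
    qed (fact finF)
  qed
  moreover have "card ?I = card A + card (?I - A)"
  proof -
    have "A \<subseteq> ?I" unfolding A_def by blast
    then show ?thesis
      using card_Diff_subset[of A ?I] card_mono[OF finI] finite_subset[OF _ finI] by simp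
  qed
  ultimately show ?thesis by linarith
qed

text \<open>For \<open>t\<close> near \<open>card L powr (2/3) / card V powr (1/3)\<close>, if this is at least
\<open>1\<close>, division by \<open>t\<^sup>2\<close> gives the usual bound of order
\<open>(card V * card L) powr (2/3) + card L\<close>.\<close>

theorem szemeredi_trotter:
  assumes V: "finite V" and L: "finite L" and t: "t \<ge> (1::nat)"
  shows "card {(p, l) \<in> V \<times> L. on_line p l} * t\<^sup>2 \<le> card L * t\<^sup>2 + 3 * card V * t ^ 3 + (card L)\<^sup>2"
proof -
  let ?F = "{e. \<exists>l\<in>L. consecutive_on V l e}"
  have "card {(p, l) \<in> V \<times> L. on_line p l} * t\<^sup>2 \<le> (card L + card ?F) * t\<^sup>2"
    by (rule mult_right_mono[OF card_incidences_le_consecutive[OF V L]]) simp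
  also have "\<dots> = card L * t\<^sup>2 + card ?F * t\<^sup>2"
    by (rule add_mult_distrib)
  also have "\<dots> \<le> card L * t\<^sup>2 + (3 * card V * t ^ 3 + (card L)\<^sup>2)"
    using crossing_inequality[OF straight_graph_consecutive[OF V, of L] t]
      card_crossings_consecutive[OF L, of V] by linarith
  finally show ?thesis by linarith
qed

section \<open>Prescribed dot products\<close>

lemma inner_real2: "x \<bullet> y = x $ 1 * y $ 1 + x $ 2 * y $ 2" for x y :: "real ^ 2"
  by (simp add: inner_vec_def sum_2)

lemma real2_eq_iff: "x = y \<longleftrightarrow> x $ 1 = y $ 1 \<and> x $ 2 = y $ 2" for x y :: "real ^ 2"
  by (simp add: vec_eq_iff forall_2)

text \<open>The equation \<open>x \<bullet> y = a\<close> is solved for the second coordinate of \<open>y\<close>. Since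
\<open>a \<noteq> 0\<close>, the intercept \<open>a / x $ 2\<close> determines \<open>x $ 2\<close>, and then the
slope determines \<open>x $ 1\<close>.\<close>

lemma card_dot_pairs_nonvertical:
  fixes E :: "(real ^ 2) set"
  assumes E: "finite E" and a: "a \<noteq> 0" and t: "t \<ge> (1::nat)"
  shows "card {(x, y) \<in> E \<times> E. x \<bullet> y = a \<and> x $ 2 \<noteq> 0} * t\<^sup>2
    \<le> card E * t\<^sup>2 + 3 * card E * t ^ 3 + (card E)\<^sup>2"
proof -
  define pt where "pt y = (y $ 1, y $ 2)" for y :: "real ^ 2"
  define ln where "ln x = (- (x $ 1 / x $ 2), a / x $ 2)" for x :: "real ^ 2"
  let ?V = "pt ` E" and ?L = "ln ` {x \<in> E. x $ 2 \<noteq> 0}"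
  let ?P = "{(x, y) \<in> E \<times> E. x \<bullet> y = a \<and> x $ 2 \<noteq> 0}"
  let ?I = "{(p, l) \<in> ?V \<times> ?L. on_line p l}"
  have fin: "finite ?V" "finite ?L" using E by simp_all
  have ln_inj: "x = y" if "ln x = ln y" "x $ 2 \<noteq> 0" "y $ 2 \<noteq> 0" for x y
  proof -
    have "x $ 2 = y $ 2" using that a by (simp add: ln_def divide_simps)
    then show ?thesis using that by (simp add: ln_def real2_eq_iff divide_simps)
  qed
  have "card ?P \<le> card ?I"
  proof (rule card_inj_on_le[of "\<lambda>(x, y). (pt y, ln x)"])
    show "inj_on (\<lambda>(x, y). (pt y, ln x)) ?P"
      by (rule inj_onI) (auto simp: pt_def real2_eq_iff dest: ln_inj)
    have "on_line (pt y) (ln x)" if "x \<bullet> y = a" "x $ 2 \<noteq> 0" for x y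
      using that by (auto simp: on_line_def pt_def ln_def inner_real2 field_simps)
    then show "(\<lambda>(x, y). (pt y, ln x)) ` ?P \<subseteq> ?I" by auto
    show "finite ?I"
      by (rule finite_subset[of _ "?V \<times> ?L"]) (use fin in auto)
  qed
  then have "card ?P * t\<^sup>2 \<le> card ?I * t\<^sup>2" by simp
  also have "\<dots> \<le> card ?L * t\<^sup>2 + 3 * card ?V * t ^ 3 + (card ?L)\<^sup>2"
    by (rule szemeredi_trotter[OF fin t])
  also have "\<dots> \<le> card E * t\<^sup>2 + 3 * card E * t ^ 3 + (card E)\<^sup>2"
  proof -
    have "card ?V \<le> card E" using E by (rule card_image_le)
    moreover have "card ?L \<le> card E"
      using E by (intro order_trans[OF card_image_le card_mono]) auto
    ultimately show ?thesis by (intro add_mono mult_right_mono mult_left_mono power_mono) simp_all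
  qed
  finally show ?thesis .
qed

text \<open>Here the lines are vertical, and only one of them passes through a given point.\<close>

lemma card_dot_pairs_vertical:
  fixes E :: "(real ^ 2) set"
  assumes E: "finite E" and a: "a \<noteq> 0"
  shows "card {(x, y) \<in> E \<times> E. x \<bullet> y = a \<and> x $ 2 = 0} \<le> card E"
proof (rule card_inj_on_le[of snd])
  show "inj_on snd {(x, y) \<in> E \<times> E. x \<bullet> y = a \<and> x $ 2 = 0}"
    by (rule inj_onI) (use a in \<open>auto simp: inner_real2 real2_eq_iff\<close>)
qed (use E in auto)

text \<open>The choice of \<open>t\<close> as the rounded cube root of \<open>n\<close> balances the terms
\<open>3 * n * t\<close> and \<open>n\<^sup>2 / t\<^sup>2\<close>.\<close>

lemma card_dot_pairs:
  fixes E :: "(real ^ 2) set"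
  assumes E: "finite E" and a: "a \<noteq> 0"
  shows "real (card {(x, y) \<in> E \<times> E. x \<bullet> y = a}) \<le> 9 * real (card E) powr (4 / 3)"
proof (cases "E = {}")
  case False
  define n where "n = card E"
  define s where "s = real n powr (1 / 3)"
  define t where "t = nat \<lceil>s\<rceil>"
  have n: "n \<ge> 1"
    using E False by (simp add: n_def card_gt_0_iff Suc_le_eq)
  have s1: "s \<ge> 1"
    using n unfolding s_def by (intro ge_one_powr_ge_zero) auto
  have st: "s \<le> real t" "real t \<le> 2 * s"
    unfolding t_def using s1 by linarith+
  have t1: "t \<ge> 1"
    using s1 st by linarith
  have s3: "real n = s ^ 3" and s4: "real n powr (4 / 3) = s ^ 4"
    using n s1 unfolding s_def by (simp_all add: powr_powr flip: powr_numeral)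
  let ?N = "{(x, y) \<in> E \<times> E. x \<bullet> y = a \<and> x $ 2 \<noteq> 0}"
  let ?Z = "{(x, y) \<in> E \<times> E. x \<bullet> y = a \<and> x $ 2 = 0}"
  have "real (card ?N * t\<^sup>2) \<le> real (n * t\<^sup>2 + 3 * n * t ^ 3 + n\<^sup>2)"
    using card_dot_pairs_nonvertical[OF E a t1] unfolding n_def by (intro of_nat_mono)
  then have "real (card ?N) * (real t)\<^sup>2 \<le> s ^ 3 * (real t)\<^sup>2 + 3 * s ^ 3 * real t ^ 3 + (s ^ 3)\<^sup>2"
    by (simp add: s3)
  also have "\<dots> \<le> s ^ 4 * (real t)\<^sup>2 + 6 * s ^ 4 * (real t)\<^sup>2 + s ^ 4 * (real t)\<^sup>2"
  proof (intro add_mono)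
    show "s ^ 3 * (real t)\<^sup>2 \<le> s ^ 4 * (real t)\<^sup>2"
      using s1 by (intro mult_right_mono power_increasing) simp_all
    have "3 * s ^ 3 * (real t)\<^sup>2 * real t \<le> 3 * s ^ 3 * (real t)\<^sup>2 * (2 * s)"
      using st s1 by (intro mult_left_mono) simp_all
    then show "3 * s ^ 3 * real t ^ 3 \<le> 6 * s ^ 4 * (real t)\<^sup>2"
      by (simp add: numeral_eq_Suc mult_ac)
    have "s ^ 4 * s\<^sup>2 \<le> s ^ 4 * (real t)\<^sup>2"
      using st s1 by (intro mult_left_mono power_mono) simp_all
    then show "(s ^ 3)\<^sup>2 \<le> s ^ 4 * (real t)\<^sup>2"
      by (simp flip: power_mult power_add)
  qed
  also have "\<dots> = 8 * s ^ 4 * (real t)\<^sup>2" by simp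
  finally have "real (card ?N) \<le> 8 * s ^ 4"
    using t1 by simp
  moreover have "real (card ?Z) \<le> s ^ 4"
  proof -
    have "real (card ?Z) \<le> s ^ 3"
      using card_dot_pairs_vertical[OF E a] s3 unfolding n_def by simp
    also have "\<dots> \<le> s ^ 4" using s1 by (intro power_increasing) simp_all
    finally show ?thesis .
  qed
  moreover have "card {(x, y) \<in> E \<times> E. x \<bullet> y = a} \<le> card ?N + card ?Z"
  proof -
    have "{(x, y) \<in> E \<times> E. x \<bullet> y = a} = ?N \<union> ?Z" by auto
    then show ?thesis by (metis (no_types, lifting) card_Un_le)
  qed
  ultimately have "real (card {(x, y) \<in> E \<times> E. x \<bullet> y = a}) \<le> 9 * s ^ 4"
    by linarith
  then show ?thesis using s4 by (simp add: n_def)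
qed simp

section \<open>Chains\<close>

lemma finite_dot_chains: "finite E \<Longrightarrow> finite (dot_chains \<alpha> E)"
  unfolding dot_chains_def
  by (rule finite_subset[OF _ finite_lists_length_eq[of E "length \<alpha> + 1"]]) auto

lemma card_dot_chains_1:
  assumes E: "finite E" and a: "a \<noteq> 0"
  shows "real (card (dot_chains [a] E)) \<le> 9 * real (card E) powr (4 / 3)"
proof -
  have "card (dot_chains [a] E) \<le> card {(x, y) \<in> E \<times> E. x \<bullet> y = a}"
  proof (rule card_inj_on_le[of "\<lambda>R. (R ! 0, R ! 1)"])
    show "inj_on (\<lambda>R. (R ! 0, R ! 1)) (dot_chains [a] E)"
      by (rule inj_onI) (auto simp: dot_chains_def length_Suc_conv numeral_2_eq_2)
    show "(\<lambda>R. (R ! 0, R ! 1)) ` dot_chains [a] E \<subseteq> {(x, y) \<in> E \<times> E. x \<bullet> y = a}"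
      by (auto simp: dot_chains_def length_Suc_conv numeral_2_eq_2)
    show "finite {(x, y) \<in> E \<times> E. x \<bullet> y = a}"
      by (rule finite_subset[of _ "E \<times> E"]) (use E in auto)
  qed
  then show ?thesis using card_dot_pairs[OF E a] by linarith
qed

text \<open>If the determinant of the linear system vanished, then solvability would force \<open>a *\<^sub>R q\<close>
and \<open>b *\<^sub>R p\<close> to agree. Otherwise the solution is given by Cramer's rule.\<close>

lemma dot_system_unique:
  fixes p q x y :: "real ^ 2"
  assumes "p \<bullet> x = a" "q \<bullet> x = b" "p \<bullet> y = a" "q \<bullet> y = b" "a *\<^sub>R q \<noteq> b *\<^sub>R p"
  shows "x = y"
proof -
  have dots: "p $ 1 * x $ 1 + p $ 2 * x $ 2 = a" "q $ 1 * x $ 1 + q $ 2 * x $ 2 = b"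
    "p $ 1 * y $ 1 + p $ 2 * y $ 2 = a" "q $ 1 * y $ 1 + q $ 2 * y $ 2 = b"
    using assms(1-4) by (simp_all add: inner_real2)
  define D where "D = p $ 1 * q $ 2 - p $ 2 * q $ 1"
  have "a * q $ 1 - b * p $ 1 = - (D * x $ 2)" "a * q $ 2 - b * p $ 2 = D * x $ 1"
    unfolding D_def dots(1,2)[symmetric] by (simp_all add: algebra_simps)
  then have "D \<noteq> 0"
    using assms(5) by (auto simp: real2_eq_iff)
  moreover have "D * x $ 1 = q $ 2 * a - p $ 2 * b"
    unfolding D_def dots(1,2)[symmetric] by (simp add: algebra_simps)
  moreover have "D * y $ 1 = q $ 2 * a - p $ 2 * b"
    unfolding D_def dots(3,4)[symmetric] by (simp add: algebra_simps)
  moreover have "D * x $ 2 = p $ 1 * b - q $ 1 * a"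
    unfolding D_def dots(1,2)[symmetric] by (simp add: algebra_simps)
  moreover have "D * y $ 2 = p $ 1 * b - q $ 1 * a"
    unfolding D_def dots(3,4)[symmetric] by (simp add: algebra_simps)
  ultimately show ?thesis
    by (metis mult_left_cancel real2_eq_iff)
qed

text \<open>The first and the last point determine the middle one, unless the two equations for the middle point are
proportional. In the proportional case the last point is a fixed multiple of the first, so the first two
points determine the chain.\<close>

lemma card_dot_chains_2:
  assumes E: "finite E" and a: "a \<noteq> 0"
  shows "card (dot_chains [a, b] E) \<le> 2 * (card E)\<^sup>2"
proof -
  \<comment> \<open>\<open>?D\<close> consists of the chains with proportional equations, \<open>?U\<close> of those with a
    unique middle point.\<close>
  let ?D = "{R \<in> dot_chains [a, b] E. a *\<^sub>R (R ! 2) = b *\<^sub>R (R ! 0)}"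
  let ?U = "{R \<in> dot_chains [a, b] E. a *\<^sub>R (R ! 2) \<noteq> b *\<^sub>R (R ! 0)}"
  have form: "\<exists>x y z. R = [x, y, z] \<and> x \<in> E \<and> y \<in> E \<and> z \<in> E \<and> x \<bullet> y = a \<and> y \<bullet> z = b"
    if "R \<in> dot_chains [a, b] E" for R
  proof -
    have "length R = Suc (Suc (Suc 0))"
      using that by (simp add: dot_chains_def)
    then obtain x y z where R: "R = [x, y, z]"
      by (auto simp: length_Suc_conv)
    moreover have "x \<in> E" "y \<in> E" "z \<in> E"
      using that by (simp_all add: dot_chains_def R)
    moreover have dot: "\<forall>j<2. [x, y, z] ! j \<bullet> [x, y, z] ! (j + 1) = [a, b] ! j"
      using that by (simp add: dot_chains_def R)
    moreover have "x \<bullet> y = a" "y \<bullet> z = b"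
      using dot[rule_format, of 0] dot[rule_format, of 1] by simp_all
    ultimately show ?thesis by blast
  qed
  have mem: "R ! 0 \<in> E" "R ! 1 \<in> E" "R ! 2 \<in> E" if "R \<in> dot_chains [a, b] E" for R
    using that by (auto simp: dot_chains_def subset_iff)
  have "card ?D \<le> card (E \<times> E)"
  proof (rule card_inj_on_le[of "\<lambda>R. (R ! 0, R ! 1)"])
    show "inj_on (\<lambda>R. (R ! 0, R ! 1)) ?D"
    proof (rule inj_onI)
      fix R S assume RS: "R \<in> ?D" "S \<in> ?D" "(R ! 0, R ! 1) = (S ! 0, S ! 1)"
      then have "a *\<^sub>R (R ! 2) = a *\<^sub>R (S ! 2)" by simp
      then have "R ! 2 = S ! 2" using a by simp
      moreover obtain x y z where "R = [x, y, z]"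
        using form[of R] RS(1) by blast
      moreover obtain x' y' z' where "S = [x', y', z']"
        using form[of S] RS(2) by blast
      ultimately show "R = S" using RS(3) by simp
    qed
  qed (use E mem in auto)
  moreover have "card ?U \<le> card (E \<times> E)"
  proof (rule card_inj_on_le[of "\<lambda>R. (R ! 0, R ! 2)"])
    show "inj_on (\<lambda>R. (R ! 0, R ! 2)) ?U"
    proof (rule inj_onI)
      fix R S assume RS: "R \<in> ?U" "S \<in> ?U" "(R ! 0, R ! 2) = (S ! 0, S ! 2)"
      obtain x y z where R: "R = [x, y, z]" "x \<bullet> y = a" "y \<bullet> z = b"
        using form[of R] RS(1) by blast
      obtain x' y' z' where S: "S = [x', y', z']" "x' \<bullet> y' = a" "y' \<bullet> z' = b"
        using form[of S] RS(2) by blast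
      have "x' = x" "z' = z" "a *\<^sub>R z \<noteq> b *\<^sub>R x"
        using RS R S by simp_all
      then have "y = y'"
        using dot_system_unique[of x y a z b y'] R S by (simp add: inner_commute)
      then show "R = S" using R S \<open>x' = x\<close> \<open>z' = z\<close> by simp
    qed
  qed (use E mem in auto)
  moreover have "card (dot_chains [a, b] E) \<le> card ?D + card ?U"
  proof -
    have "dot_chains [a, b] E = ?D \<union> ?U" by blast
    then show ?thesis by (metis (no_types, lifting) card_Un_le)
  qed
  ultimately show ?thesis
    by (simp add: card_cartesian_product power2_eq_square)
qed

text \<open>The entry \<open>b\<close> constrains only the link between the two parts, and this constraint is dropped.\<close>

lemma card_dot_chains_split:
  assumes E: "finite E"
  shows "card (dot_chains (a # b # \<alpha>) E) \<le> card (dot_chains [a] E) * card (dot_chains \<alpha> E)"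
proof -
  have "card (dot_chains (a # b # \<alpha>) E) \<le> card (dot_chains [a] E \<times> dot_chains \<alpha> E)"
  proof (rule card_inj_on_le[of "\<lambda>R. (take 2 R, drop 2 R)"])
    show "inj_on (\<lambda>R. (take 2 R, drop 2 R)) (dot_chains (a # b # \<alpha>) E)"
      by (rule inj_onI) (metis append_take_drop_id prod.inject)
    have "take 2 R \<in> dot_chains [a] E \<and> drop 2 R \<in> dot_chains \<alpha> E"
      if R: "R \<in> dot_chains (a # b # \<alpha>) E" for R
    proof -
      have len: "length R = length \<alpha> + 3" and sub: "set R \<subseteq> E"
        and dot: "\<And>j. j < length \<alpha> + 2 \<Longrightarrow> (R ! j) \<bullet> (R ! (j + 1)) = (a # b # \<alpha>) ! j"
        using R by (simp_all add: dot_chains_def)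
      have "(R ! 0) \<bullet> (R ! 1) = a"
        using dot[of 0] by simp
      moreover have "drop 2 R ! j \<bullet> drop 2 R ! (j + 1) = \<alpha> ! j" if "j < length \<alpha>" for j
        using dot[of "j + 2"] that len by (simp add: add.commute)
      ultimately show ?thesis
        using len sub by (auto simp: dot_chains_def dest: in_set_takeD in_set_dropD)
    qed
    then show "(\<lambda>R. (take 2 R, drop 2 R)) ` dot_chains (a # b # \<alpha>) E \<subseteq> dot_chains [a] E \<times> dot_chains \<alpha> E"
      by auto
  qed (simp add: finite_dot_chains E)
  then show ?thesis by (simp add: card_cartesian_product)
qed

text \<open>The exponent \<open>2 * (k + 1) / 3\<close> is two thirds of the number of points of the chain, hence it is
additive when the chain is split into two parts.\<close>

lemma card_dot_chains_le:
  assumes E: "finite E" and "\<alpha> \<noteq> []" and "\<forall>a\<in>set \<alpha>. a \<noteq> 0"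
  shows "real (card (dot_chains \<alpha> E))
    \<le> 9 ^ length \<alpha> * real (card E) powr (2 * (real (length \<alpha>) + 1) / 3)"
  using assms(2,3)
proof (induction \<alpha> rule: induct_list012)
  case 1
  then show ?case by simp
next
  case (2 a)
  then show ?case using card_dot_chains_1[OF E] by simp
next
  case (3 a b \<alpha>)
  let ?n = "real (card E)"
  show ?case
  proof (cases "\<alpha> = []")
    case True
    have "real (card (dot_chains [a, b] E)) \<le> real (2 * (card E)\<^sup>2)"
      using card_dot_chains_2[OF E, of a b] 3 by (intro of_nat_mono) simp
    also have "\<dots> = 2 * ?n powr 2"
      by simp
    also have "\<dots> \<le> 81 * ?n powr 2"
      by (intro mult_right_mono) simp_all
    finally show ?thesis using True by simp
  next
    case False
    let ?k = "real (length \<alpha>)"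
    have "real (card (dot_chains (a # b # \<alpha>) E)) \<le> real (card (dot_chains [a] E) * card (dot_chains \<alpha> E))"
      using card_dot_chains_split[OF E] by (intro of_nat_mono)
    also have "\<dots> = real (card (dot_chains [a] E)) * real (card (dot_chains \<alpha> E))"
      by simp
    also have "\<dots> \<le> (9 * ?n powr (4 / 3)) * (9 ^ length \<alpha> * ?n powr (2 * (?k + 1) / 3))"
      by (intro mult_mono card_dot_chains_1[OF E] 3) (use 3 False in auto)
    also have "\<dots> = 9 ^ (length \<alpha> + 1) * (?n powr (4 / 3) * ?n powr (2 * (?k + 1) / 3))"
      by simp
    also have "?n powr (4 / 3) * ?n powr (2 * (?k + 1) / 3) = ?n powr (2 * (real (length (a # b # \<alpha>)) + 1) / 3)"
      unfolding powr_add[symmetric] by (rule arg_cong[of _ _ "\<lambda>u. ?n powr u"]) (simp add: field_simps)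
    also have "9 ^ (length \<alpha> + 1) * \<dots> \<le> 9 ^ length (a # b # \<alpha>) * \<dots>"
      by (intro mult_right_mono power_increasing) simp_all
    finally show ?thesis .
  qed
qed

theorem theorem1p2:
  shows "\<forall>k::nat. k \<ge> 1 \<longrightarrow>
    (\<exists>(C::real) (N::nat). C > 0 \<and>
      (\<forall>(n::nat) (E::(real ^ 2) set) (\<alpha>::real list).
         n > N \<longrightarrow> finite E \<longrightarrow> card E = n \<longrightarrow> length \<alpha> = k \<longrightarrow> (\<forall>a \<in> set \<alpha>. a \<noteq> 0) \<longrightarrow>
         real (card (dot_chains \<alpha> E)) \<le> C * real n powr (2 * (real k + 1) / 3)))"
proof (intro allI impI)
  fix k :: nat assume k: "k \<ge> 1"
  show "\<exists>(C::real) (N::nat). C > 0 \<and>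
      (\<forall>(n::nat) (E::(real ^ 2) set) (\<alpha>::real list).
         n > N \<longrightarrow> finite E \<longrightarrow> card E = n \<longrightarrow> length \<alpha> = k \<longrightarrow> (\<forall>a \<in> set \<alpha>. a \<noteq> 0) \<longrightarrow>
         real (card (dot_chains \<alpha> E)) \<le> C * real n powr (2 * (real k + 1) / 3))"
  proof (intro exI[of _ "9 ^ k"] exI[of _ 0] conjI allI impI)
    fix n :: nat and E :: "(real ^ 2) set" and \<alpha> :: "real list"
    assume "finite E" "card E = n" "length \<alpha> = k" "\<forall>a\<in>set \<alpha>. a \<noteq> 0"
    then show "real (card (dot_chains \<alpha> E)) \<le> 9 ^ k * real n powr (2 * (real k + 1) / 3)"
      using card_dot_chains_le[of E \<alpha>] k by force
  qed simp
qed

end
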